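(* Let $m,n\in\mathbb{N}$ with $m<n$, let $s\le n$, let $M\in\mathbb{R}^{m\times n}$ have full rank, let $p\in\mathbb{R}^m$, and set $A_s=\{x\in\mathbb{R}^n : \|x\|_0\le s\}$ and $B=\{x\in\mathbb{R}^n : Mx=p\}$. Let $M$ satisfy the scaled/asymmetric restricted isometry property of order $(2s,2)$ with $\mu_{2s}=1$, that is, there is $\nu_{2s}>0$ with $1\le\frac{1}{\nu_{2s}}<2$ such that $$\nu_{2s}\|x\|_2^2\le\|Mx\|_2^2\le\|x\|_2^2\qquad\text{for all }x\in A_{2s},$$ and let $MM^\top=\mathrm{Id}$. Then $A_s\cap B$ is a singleton, and alternating projections applied to the problem of finding a point of $A_s\cap B$, i.e. $x^{k+1}\in P_{A_s}P_Bx^k$ $(k\in\mathbb{N})$, converges linearly to $A_s\cap B$ with rate $\rho=\left(\frac{1}{\nu_{2s}}-1\right)<1$ for every initial point $x^0$.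
   Context: $\|x\|_0$ is the number of nonzero entries of $x$; $A_{2s}=\{x\in\mathbb{R}^n:\|x\|_0\le 2s\}$; $\mathbb{N}$ denotes the nonnegative integers. For closed nonempty $\Omega\subset\mathbb{R}^n$ the (possibly set-valued) projector is $P_\Omega(x)=\operatorname{argmin}_{y\in\Omega}\|x-y\|_2$.
   Formalization: The formal theorem additionally assumes that A_s ∩ B is nonempty; without this the claim fails, e.g. s=0, M=(1 0), p=1, ν=1, where the intersection is empty. The degenerate case m=0 is not covered. *)

theory Defs
  imports "HOL-Analysis.Analysis"
begin

definition l0 :: "real^'n \<Rightarrow> nat" where
  "l0 x = card {i. x $ i \<noteq> 0}"

definition sparse_set :: "nat \<Rightarrow> (real^'n) set" where
  "sparse_set s = {x. l0 x \<le> s}"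

definition affine_set :: "real^'n^'m \<Rightarrow> real^'m \<Rightarrow> (real^'n) set" where
  "affine_set M p = {x. M *v x = p}"

(* Set-valued; closest_point from the library would select a single nearest point. *)
definition projector :: "(real^'n) set \<Rightarrow> real^'n \<Rightarrow> (real^'n) set" where
  "projector \<Omega> x = {y. is_arg_min (\<lambda>y. norm (x - y)) (\<lambda>y. y \<in> \<Omega>) y}"

definition alternating_projections ::
  "(real^'n) set \<Rightarrow> (real^'n) set \<Rightarrow> (nat \<Rightarrow> real^'n) \<Rightarrow> bool" where
  "alternating_projections A B x \<longleftrightarrow>
     (\<forall>k. x (Suc k) \<in> (\<Union>y\<in>projector B (x k). projector A y))"

(* Scaled/asymmetric restricted isometry property of order (r, a) with constants nu, mu. *)
definition asymmetric_rip :: "real^'n^'m \<Rightarrow> nat \<Rightarrow> real \<Rightarrow> real \<Rightarrow> real \<Rightarrow> bool" where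
  "asymmetric_rip M r a \<nu> \<mu> \<longleftrightarrow>
     0 < \<nu> \<and> 0 < \<mu> \<and> 1 \<le> \<mu> / \<nu> \<and> \<mu> / \<nu> < a \<and>
     (\<forall>x\<in>sparse_set r.
        \<nu> * (norm x)\<^sup>2 \<le> (norm (M *v x))\<^sup>2 \<and> (norm (M *v x))\<^sup>2 \<le> \<mu> * (norm x)\<^sup>2)"

(* Linear convergence with rate rho in the root-linear sense customary for alternating
   projections: the constant may depend on the sequence. As 0 ^ 0 = 1, rate 0 means that
   the limit is attained from k = 1 on. *)
definition converges_linearly ::
  "(nat \<Rightarrow> 'a::real_normed_vector) \<Rightarrow> 'a \<Rightarrow> real \<Rightarrow> bool" where
  "converges_linearly x xbar \<rho> \<longleftrightarrow>
     0 \<le> \<rho> \<and> \<rho> < 1 \<and> (\<exists>C\<ge>0. \<forall>k. norm (x k - xbar) \<le> C * \<rho> ^ k)"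

end

theory Submission
  imports Defs
begin

text \<open>
  Write \<open>e k = x k - xbar\<close>. As \<open>M\<close> has orthonormal rows, the projection of \<open>x\<close> onto the affine
  set is the gradient step \<open>x - transpose M *v (M *v x - p)\<close>, so one sweep is a step of iterative
  hard thresholding. Comparing the new iterate with \<open>xbar\<close> in the minimality condition shows that
  the squared residual \<open>(norm (M *v e k))\<^sup>2\<close> contracts by \<open>1/\<nu> - 1\<close>. This only gives the rate
  \<open>sqrt (1/\<nu> - 1)\<close>, but it gives convergence; hence eventually every iterate is nonzero
  wherever \<open>xbar\<close> is. From then on thresholding acts as an orthogonal projection relative
  to \<open>xbar\<close>, and polarising the form \<open>u \<bullet> v - (M *v u) \<bullet> (M *v v)\<close> on \<open>2s\<close>-sparse vectors yields
  \<open>norm (e (k + 1)) \<le> (1 - \<nu>) * norm (e k)\<close>, where \<open>1 - \<nu> \<le> 1/\<nu> - 1\<close>. Rate \<open>0\<close> occurs only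
  for \<open>s = 0\<close>, because \<open>\<nu> = 1\<close> and \<open>s > 0\<close> would make \<open>M\<close> injective.
\<close>

text \<open>As a simp rule it turns \<open>transpose M *v w\<close> into \<open>w v* M\<close>,
  hiding the form in which the gradient step is rewritten below.\<close>

declare transpose_matrix_vector [simp del]

section \<open>Sparsity of sums and differences\<close>

lemma l0_add_le: "l0 (x + y) \<le> l0 x + l0 y"
proof -
  have "l0 (x + y) \<le> card ({i. x $ i \<noteq> 0} \<union> {i. y $ i \<noteq> 0})"
    unfolding l0_def by (rule card_mono) auto
  then show ?thesis
    unfolding l0_def using card_Un_le order_trans by blast
qed

lemma l0_mono: "(\<And>i. y $ i = 0 \<Longrightarrow> x $ i = 0) \<Longrightarrow> l0 x \<le> l0 y"
  unfolding l0_def by (rule card_mono) auto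

lemma sparse_set_lincomb:
  assumes "u \<in> sparse_set s" "v \<in> sparse_set s"
  shows "a *\<^sub>R u + b *\<^sub>R v \<in> sparse_set (2 * s)"
proof -
  have "l0 (a *\<^sub>R u + b *\<^sub>R v) \<le> l0 (a *\<^sub>R u) + l0 (b *\<^sub>R v)" by (rule l0_add_le)
  also have "\<dots> \<le> l0 u + l0 v" by (intro add_mono l0_mono) auto
  finally show ?thesis using assms by (simp add: sparse_set_def)
qed

lemma sparse_set_diff:
  "u \<in> sparse_set s \<Longrightarrow> v \<in> sparse_set s \<Longrightarrow> u - v \<in> sparse_set (2 * s)"
  using sparse_set_lincomb[of u s v 1 "-1"] by simp

section \<open>Adjoints, projectors and orthonormal rows\<close>

lemma inner_transpose_matrix_vector:
  fixes M :: "real^'n^'m"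
  shows "(transpose M *v w) \<bullet> v = w \<bullet> (M *v v)"
  by (simp add: transpose_matrix_vector dot_lmul_matrix)

lemma asymmetric_ripD:
  assumes "asymmetric_rip M r a \<nu> \<mu>" "x \<in> sparse_set r"
  shows "\<nu> * (norm x)\<^sup>2 \<le> (norm (M *v x))\<^sup>2" "(norm (M *v x))\<^sup>2 \<le> \<mu> * (norm x)\<^sup>2"
  using assms unfolding asymmetric_rip_def by blast+

lemma coisometry_apply:
  fixes M :: "real^'n^'m"
  assumes "M ** transpose M = mat 1"
  shows "M *v (transpose M *v w) = w"
  by (simp add: matrix_vector_mul_assoc assms)

lemma projectorD:
  assumes "y \<in> projector \<Omega> x"
  shows "y \<in> \<Omega>" "\<And>z. z \<in> \<Omega> \<Longrightarrow> norm (x - y) \<le> norm (x - z)"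
  using assms by (auto simp: projector_def is_arg_min_def not_less)

text \<open>Since \<open>transpose M\<close> is a right inverse of \<open>M\<close>, the gradient
  step is feasible, and its displacement lies in the range of \<open>transpose M\<close>, orthogonal
  to the kernel of \<open>M\<close>. Pythagoras then leaves no other minimiser.\<close>

lemma projector_affine_set:
  fixes M :: "real^'n^'m"
  assumes coisometry: "M ** transpose M = mat 1"
    and y: "y \<in> projector (affine_set M p) x"
  shows "y = x - transpose M *v (M *v x - p)"
proof -
  define w where "w = x - transpose M *v (M *v x - p)"
  have "M *v w = p"
    by (simp add: w_def matrix_vector_mult_diff_distrib coisometry_apply[OF coisometry])
  then have "norm (x - y) \<le> norm (x - w)" and "M *v (w - y) = 0"
    using projectorD[OF y] by (auto simp: affine_set_def matrix_vector_mult_diff_distrib)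
  moreover from this have "(x - w) \<bullet> (w - y) = 0"
    by (simp add: w_def inner_transpose_matrix_vector)
  then have "(norm (x - y))\<^sup>2 = (norm (x - w))\<^sup>2 + (norm (w - y))\<^sup>2"
    using norm_add_Pythagorean[of "x - w" "w - y"] by (simp add: orthogonal_def)
  ultimately have "(norm (w - y))\<^sup>2 \<le> 0"
    by (smt (verit) norm_ge_zero power_mono)
  then show ?thesis by (simp add: w_def)
qed

text \<open>Otherwise \<open>M\<close> preserves the length of every coordinate vector. As
  \<open>transpose M ** M\<close> is an orthogonal projection, it then fixes them all, which makes
  \<open>M\<close> injective despite having fewer rows than columns.\<close>

lemma rip_constant_less_one:
  fixes M :: "real^'n^'m"
  assumes "CARD('m) < CARD('n)" "M ** transpose M = mat 1"
    and rip: "asymmetric_rip M r a \<nu> 1" and "0 < r"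
  shows "\<nu> < 1"
proof (rule ccontr)
  assume "\<not> \<nu> < 1"
  have "transpose M *v (M *v axis i 1) = axis i 1" for i
  proof -
    define g :: "real^'n" where "g = axis i 1"
    have "l0 g \<le> card {i}"
      unfolding l0_def g_def by (rule card_mono) (auto simp: axis_def)
    then have "g \<in> sparse_set r" and "norm g = 1"
      using \<open>0 < r\<close> by (simp_all add: sparse_set_def g_def)
    then have "\<nu> \<le> (norm (M *v g))\<^sup>2" "(norm (M *v g))\<^sup>2 \<le> 1"
      using asymmetric_ripD[OF rip] by fastforce+
    with \<open>\<not> \<nu> < 1\<close> have unit: "(M *v g) \<bullet> (M *v g) = 1"
      by (simp add: power2_norm_eq_inner)
    have "(transpose M *v (M *v g)) \<bullet> (transpose M *v (M *v g)) = 1"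
      by (simp add: inner_transpose_matrix_vector coisometry_apply[OF assms(2)] unit)
    moreover have "(transpose M *v (M *v g)) \<bullet> g = 1"
      by (simp only: inner_transpose_matrix_vector unit)
    moreover have "g \<bullet> g = 1" by (simp add: g_def inner_axis_axis)
    ultimately have "(transpose M *v (M *v g) - g) \<bullet> (transpose M *v (M *v g) - g) = 0"
      by (simp add: inner_diff_left inner_diff_right inner_commute)
    then show ?thesis by (simp add: g_def)
  qed
  then have "column i (transpose M ** M) = column i (mat 1)" for i
    by (simp add: matrix_vector_mult_basis[symmetric] matrix_vector_mul_assoc[symmetric])
  then have "transpose M ** M = mat 1"
    by (simp add: vec_eq_iff column_def)
  then have "inj ((*v) M)" using matrix_left_invertible_injective by blast
  then have "rank M = CARD('n)" using full_rank_injective by blast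
  then show False using rank_bound[of M] assms(1) by simp
qed

section \<open>One-step contraction of hard thresholding\<close>

lemma hard_thresholding_residual_contraction:
  fixes M :: "real^'n^'m"
  assumes rip: "asymmetric_rip M (2 * s) a \<nu> 1"
    and "x \<in> sparse_set s" "xbar \<in> sparse_set s" "M *v xbar = p"
    and x': "x' \<in> projector (sparse_set s) (x - transpose M *v (M *v x - p))"
  shows "(norm (M *v (x' - xbar)))\<^sup>2 \<le> (1 / \<nu> - 1) * (norm (M *v (x - xbar)))\<^sup>2"
proof -
  define e where "e = x - xbar"
  define d where "d = x' - x"
  define g where "g = transpose M *v (M *v e)"
  have "0 < \<nu>" using rip by (simp add: asymmetric_rip_def)
  have g: "x - transpose M *v (M *v x - p) = x - g"
    by (simp add: g_def e_def matrix_vector_mult_diff_distrib assms)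
  have "norm (d + g) \<le> norm (e - g)"
    using projectorD(2)[OF x'[unfolded g] assms(3)]
    by (simp add: d_def e_def algebra_simps norm_minus_commute)
  then have "(norm (d + g))\<^sup>2 \<le> (norm (e - g))\<^sup>2"
    by (simp add: power_mono)
  then have 1: "(norm d)\<^sup>2 + 2 * (g \<bullet> d) \<le> (norm e)\<^sup>2 - 2 * (g \<bullet> e)"
    by (simp add: power2_norm_eq_inner algebra_simps inner_commute)
  have 2: "(norm (M *v d))\<^sup>2 \<le> (norm d)\<^sup>2"
    using asymmetric_ripD(2)[OF rip sparse_set_diff[OF projectorD(1)[OF x'] assms(2)]]
    by (simp add: d_def)
  have 3: "\<nu> * (norm e)\<^sup>2 \<le> (norm (M *v e))\<^sup>2"
    using asymmetric_ripD(1)[OF rip sparse_set_diff[OF assms(2,3)]] by (simp add: e_def)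
  have "x' - xbar = e + d" by (simp add: e_def d_def)
  then have "(norm (M *v (x' - xbar)))\<^sup>2
      = (norm (M *v e))\<^sup>2 + 2 * (g \<bullet> d) + (norm (M *v d))\<^sup>2"
    by (simp add: g_def inner_transpose_matrix_vector matrix_vector_right_distrib
        power2_norm_eq_inner inner_add_left inner_add_right inner_commute[of "M *v d" "M *v e"])
  \<comment> \<open>The upper constant 1 matches the unit gradient step: the quadratic term in
    \<open>M *v d\<close> is absorbed by \<open>(norm d)\<^sup>2\<close>.\<close>
  also have "\<dots> \<le> (norm (M *v e))\<^sup>2 + (norm e)\<^sup>2 - 2 * (g \<bullet> e)" using 1 2 by linarith
  also have "\<dots> = (norm e)\<^sup>2 - (norm (M *v e))\<^sup>2"
    by (simp add: g_def inner_transpose_matrix_vector power2_norm_eq_inner)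
  also have "\<dots> \<le> (1 / \<nu> - 1) * (norm (M *v e))\<^sup>2"
    using 3 \<open>0 < \<nu>\<close> by (simp add: field_simps)
  finally show ?thesis by (simp add: e_def)
qed

text \<open>A Cauchy-Schwarz inequality for the form, whose quadratic values on
  \<open>2 * s\<close>-sparse vectors lie between 0 and \<open>1 - \<nu>\<close> times the squared
  norm.\<close>

lemma rip_polarization:
  fixes M :: "real^'n^'m"
  assumes rip: "asymmetric_rip M (2 * s) a \<nu> 1"
    and u: "u \<in> sparse_set s" and v: "v \<in> sparse_set s"
  shows "u \<bullet> v - (M *v u) \<bullet> (M *v v) \<le> (1 - \<nu>) * (norm u * norm v)"
proof (cases "u = 0 \<or> v = 0")
  case True
  then show ?thesis by auto
next
  case False
  define b c where "b = norm u" and "c = norm v"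
  have pos: "b > 0" "c > 0" using False by (auto simp: b_def c_def)
  have "0 < \<nu>" "\<nu> \<le> 1" using rip by (auto simp: asymmetric_rip_def)
  \<comment> \<open>The crossed weights give both summands the norm \<open>b * c\<close>, so
    polarisation produces the product of the norms.\<close>
  define w where "w = c *\<^sub>R u + b *\<^sub>R v"
  define z where "z = c *\<^sub>R u + (- b) *\<^sub>R v"
  have w: "\<nu> * (norm w)\<^sup>2 \<le> (norm (M *v w))\<^sup>2" and z: "(norm (M *v z))\<^sup>2 \<le> (norm z)\<^sup>2"
    using asymmetric_ripD(1)[OF rip sparse_set_lincomb[OF u v, of c b]]
      asymmetric_ripD(2)[OF rip sparse_set_lincomb[OF u v, of c "- b"]]
    by (simp_all only: w_def z_def mult_1)
  have "4 * (b * c) * (u \<bullet> v - (M *v u) \<bullet> (M *v v))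
      = ((norm w)\<^sup>2 - (norm (M *v w))\<^sup>2) - ((norm z)\<^sup>2 - (norm (M *v z))\<^sup>2)"
    by (simp add: w_def z_def power2_norm_eq_inner matrix_vector_right_distrib
        matrix_vector_mult_diff_distrib matrix_vector_mult_scaleR algebra_simps inner_commute)
  also have "\<dots> \<le> (1 - \<nu>) * (norm w)\<^sup>2" using w z by (simp only: left_diff_distrib)
  also have "\<dots> \<le> (1 - \<nu>) * (2 * (b * c))\<^sup>2"
  proof -
    have "norm w \<le> 2 * (b * c)"
      using norm_triangle_ineq[of "c *\<^sub>R u" "b *\<^sub>R v"] pos by (simp add: w_def b_def c_def)
    then show ?thesis using \<open>\<nu> \<le> 1\<close> by (intro mult_left_mono power_mono) auto
  qed
  also have "\<dots> = 4 * (b * c) * ((1 - \<nu>) * (b * c))"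
    by (simp add: power2_eq_square)
  finally show ?thesis using pos by (simp add: b_def c_def)
qed

text \<open>The sparse set is not convex, but \<open>supp\<close> keeps the segment from
  \<open>x'\<close> to \<open>xbar\<close> inside it. So \<open>x'\<close> is a nearest point of a
  convex set, and the obtuse-angle inequality applies.\<close>

lemma hard_thresholding_local_contraction:
  fixes M :: "real^'n^'m"
  assumes rip: "asymmetric_rip M (2 * s) a \<nu> 1"
    and x: "x \<in> sparse_set s" and p: "M *v xbar = p"
    and x': "x' \<in> projector (sparse_set s) (x - transpose M *v (M *v x - p))"
    and supp: "\<And>i. x $ i = 0 \<Longrightarrow> xbar $ i = 0" "\<And>i. x' $ i = 0 \<Longrightarrow> xbar $ i = 0"
  shows "norm (x' - xbar) \<le> (1 - \<nu>) * norm (x - xbar)"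
proof -
  define q where "q = x - transpose M *v (M *v x - p)"
  have x's: "x' \<in> sparse_set s" using projectorD(1)[OF x'] .
  \<comment> \<open>The supports are nested, so the errors are \<open>s\<close>-sparse and not
    merely \<open>2 * s\<close>-sparse, as polarisation at order \<open>2 * s\<close>
    demands.\<close>
  have e: "x - xbar \<in> sparse_set s" "x' - xbar \<in> sparse_set s"
    using l0_mono[of x "x - xbar"] l0_mono[of x' "x' - xbar"] supp x x's
    by (auto simp: sparse_set_def)
  have seg: "closed_segment x' xbar \<subseteq> sparse_set s"
  proof
    fix z assume "z \<in> closed_segment x' xbar"
    then have "z $ i = 0" if "x' $ i = 0" for i
      using that supp(2)[of i] by (auto simp: closed_segment_def)
    then have "l0 z \<le> l0 x'" by (intro l0_mono)
    then show "z \<in> sparse_set s" using x's by (simp add: sparse_set_def)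
  qed
  have "(q - x') \<bullet> (xbar - x') \<le> 0"
    using projectorD(2)[OF x'] seg
    by (intro any_closest_point_dot[of "closed_segment x' xbar"])
       (auto simp: q_def dist_norm)
  then have "(norm (x' - xbar))\<^sup>2 \<le> (q - xbar) \<bullet> (x' - xbar)"
    by (simp add: power2_norm_eq_inner algebra_simps inner_commute)
  also have "q - xbar = (x - xbar) - transpose M *v (M *v (x - xbar))"
    by (simp add: q_def matrix_vector_mult_diff_distrib p)
  also have "\<dots> \<bullet> (x' - xbar)
      = (x - xbar) \<bullet> (x' - xbar) - (M *v (x - xbar)) \<bullet> (M *v (x' - xbar))"
    by (simp only: inner_diff_left[of "x - xbar"] inner_transpose_matrix_vector)
  also have "\<dots> \<le> (1 - \<nu>) * (norm (x - xbar) * norm (x' - xbar))"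
    by (rule rip_polarization[OF rip e])
  finally have *: "norm (x' - xbar) * norm (x' - xbar)
      \<le> ((1 - \<nu>) * norm (x - xbar)) * norm (x' - xbar)"
    by (simp add: power2_eq_square mult.assoc)
  have "\<nu> \<le> 1" using rip by (auto simp: asymmetric_rip_def)
  show ?thesis
  proof (cases "x' = xbar")
    case False
    then show ?thesis using mult_right_le_imp_le[OF *] by simp
  qed (simp add: \<open>\<nu> \<le> 1\<close>)
qed

section \<open>From contraction to convergence\<close>

lemma geometric_decay:
  fixes f :: "nat \<Rightarrow> real"
  assumes "0 \<le> \<rho>" "\<And>k. f (Suc k) \<le> \<rho> * f k"
  shows "f k \<le> f 0 * \<rho> ^ k"
proof (induction k)
  case (Suc k)
  have "f (Suc k) \<le> \<rho> * (f 0 * \<rho> ^ k)"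
    using assms Suc.IH by (meson mult_left_mono order_trans)
  then show ?case by (simp add: mult_ac)
qed simp

text \<open>With \<open>\<rho>\<close> positive, one constant can absorb the finitely many steps
  before contraction sets in.\<close>

lemma eventually_contracting_converges_linearly:
  assumes "0 < \<rho>" "\<rho> < 1"
    and "eventually (\<lambda>k. norm (x (Suc k) - xbar) \<le> \<rho> * norm (x k - xbar)) sequentially"
  shows "converges_linearly x xbar \<rho>"
proof -
  obtain K where K: "\<And>k. k \<ge> K \<Longrightarrow> norm (x (Suc k) - xbar) \<le> \<rho> * norm (x k - xbar)"
    using assms(3) by (auto simp: eventually_sequentially)
  define C where "C = (\<Sum>k\<le>K. norm (x k - xbar) / \<rho> ^ k)"
  have C: "norm (x k - xbar) \<le> C * \<rho> ^ k" if "k \<le> K" for k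
  proof -
    have "norm (x k - xbar) / \<rho> ^ k \<le> C"
      unfolding C_def using that assms(1)
      by (intro member_le_sum[of k "{..K}" "\<lambda>k. norm (x k - xbar) / \<rho> ^ k"]) auto
    then show ?thesis using assms(1) by (simp add: field_simps)
  qed
  have "norm (x k - xbar) \<le> C * \<rho> ^ k" for k
  proof (cases "k \<le> K")
    case False
    then obtain j where j: "k = K + j" using le_Suc_ex nat_le_linear by blast
    have "norm (x (K + j) - xbar) \<le> norm (x (K + 0) - xbar) * \<rho> ^ j"
      using assms(1) K by (intro geometric_decay) auto
    also have "\<dots> \<le> (C * \<rho> ^ K) * \<rho> ^ j"
      using C[of K] assms(1) by (intro mult_right_mono) auto
    finally show ?thesis by (simp add: j power_add mult.assoc)
  qed (rule C)
  moreover have "C \<ge> 0" unfolding C_def using assms(1) by (intro sum_nonneg) auto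
  ultimately show ?thesis using assms by (auto simp: converges_linearly_def)
qed

lemma alternating_projections_tendsto:
  fixes M :: "real^'n^'m"
  assumes rip: "asymmetric_rip M (2 * s) 2 \<nu> 1"
    and sparse: "\<And>k. x (Suc k) \<in> sparse_set s" "xbar \<in> sparse_set s" and "M *v xbar = p"
    and step: "\<And>k. x (Suc k) \<in> projector (sparse_set s) (x k - transpose M *v (M *v x k - p))"
  shows "x \<longlonglongrightarrow> xbar"
proof -
  define \<rho> where "\<rho> = 1 / \<nu> - 1"
  have \<nu>: "0 < \<nu>" and \<rho>: "0 \<le> \<rho>" "\<rho> < 1" using rip by (auto simp: asymmetric_rip_def \<rho>_def)
  \<comment> \<open>The shift skips the arbitrary starting point, which may fail to be
    sparse.\<close>
  define f where "f k = (norm (M *v (x (Suc k) - xbar)))\<^sup>2" for k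
  have "f (Suc k) \<le> \<rho> * f k" for k
    using hard_thresholding_residual_contraction[OF rip sparse assms(4) step]
    by (simp add: f_def \<rho>_def)
  then have decay: "f k \<le> f 0 * \<rho> ^ k" for k using \<rho> by (intro geometric_decay)
  have bound: "(norm (x (Suc k) - xbar))\<^sup>2 \<le> (f 0 / \<nu>) * \<rho> ^ k" for k
  proof -
    have "\<nu> * (norm (x (Suc k) - xbar))\<^sup>2 \<le> f k"
      using asymmetric_ripD(1)[OF rip sparse_set_diff[OF sparse]] by (simp add: f_def)
    also note decay
    finally show ?thesis using \<nu> by (simp add: field_simps)
  qed
  have "(\<lambda>k. (f 0 / \<nu>) * \<rho> ^ k) \<longlonglongrightarrow> 0"
    using \<rho> by (intro tendsto_mult_right_zero LIMSEQ_power_zero) auto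
  then have "(\<lambda>k. (norm (x (Suc k) - xbar))\<^sup>2) \<longlonglongrightarrow> 0"
    by (rule Lim_null_comparison[rotated]) (use bound in auto)
  from tendsto_real_sqrt[OF this] have "(\<lambda>k. norm (x (Suc k) - xbar)) \<longlonglongrightarrow> 0"
    by simp
  then have "(\<lambda>k. x (Suc k)) \<longlonglongrightarrow> xbar"
    by (simp add: tendsto_norm_zero_iff LIM_zero_iff)
  then show ?thesis by (simp add: filterlim_sequentially_Suc)
qed

text \<open>Supplies the support hypotheses of the local contraction; a common threshold exists
  because there are finitely many coordinates.\<close>

lemma tendsto_eventually_support:
  fixes x :: "nat \<Rightarrow> real^'n"
  assumes "x \<longlonglongrightarrow> xbar"
  shows "eventually (\<lambda>k. \<forall>i. x k $ i = 0 \<longrightarrow> xbar $ i = 0) sequentially"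
proof (rule eventually_all_finite)
  fix i
  show "eventually (\<lambda>k. x k $ i = 0 \<longrightarrow> xbar $ i = 0) sequentially"
  proof (cases "xbar $ i = 0")
    case False
    have "(\<lambda>k. x k $ i) \<longlonglongrightarrow> xbar $ i" using assms by (rule tendsto_vec_nth)
    then have "eventually (\<lambda>k. x k $ i \<noteq> 0) sequentially"
      using False by (rule tendsto_imp_eventually_ne)
    then show ?thesis by eventually_elim simp
  qed simp
qed

text \<open>The isometry property yields uniqueness only: for \<open>s = 0\<close> and
  \<open>p\<close> nonzero the intersection is empty. Existence is therefore assumed as
  \<open>consistent\<close>.\<close>

theorem corollary3p13:
  fixes M :: "real^'n^'m" and p :: "real^'m" and s :: nat and \<nu> :: real
  assumes "CARD('m) < CARD('n)"
    and "s \<le> CARD('n)"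
    and "rank M = min CARD('m) CARD('n)"
    and "asymmetric_rip M (2 * s) 2 \<nu> 1"
    and "M ** transpose M = mat 1"
    and consistent: "sparse_set s \<inter> affine_set M p \<noteq> {}"
  shows "1 / \<nu> - 1 < 1 \<and>
    (\<exists>xbar. sparse_set s \<inter> affine_set M p = {xbar} \<and>
       (\<forall>x0 x. x 0 = x0 \<and> alternating_projections (sparse_set s) (affine_set M p) x
          \<longrightarrow> converges_linearly x xbar (1 / \<nu> - 1)))"
proof -
  note rip = assms(4)
  have \<nu>: "0 < \<nu>" "\<nu> \<le> 1" and rate: "1 / \<nu> - 1 < 1" "0 \<le> 1 / \<nu> - 1"
    using rip by (auto simp: asymmetric_rip_def)
  obtain xbar where xbar: "xbar \<in> sparse_set s" "M *v xbar = p"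
    using consistent by (auto simp: affine_set_def)
  \<comment> \<open>Two solutions differ by a \<open>2 * s\<close>-sparse kernel vector, which the
    lower bound forces to vanish.\<close>
  have "z = xbar" if "z \<in> sparse_set s" "M *v z = p" for z
  proof -
    have "\<nu> * (norm (z - xbar))\<^sup>2 \<le> (norm (M *v (z - xbar)))\<^sup>2"
      using asymmetric_ripD(1)[OF rip sparse_set_diff[OF that(1) xbar(1)]] .
    then have "\<nu> * (norm (z - xbar))\<^sup>2 \<le> 0"
      by (simp add: matrix_vector_mult_diff_distrib that xbar)
    then show ?thesis using \<nu> by (simp add: mult_le_0_iff)
  qed
  then have unique: "sparse_set s \<inter> affine_set M p = {xbar}"
    using xbar unfolding affine_set_def by blast
  have "converges_linearly x xbar (1 / \<nu> - 1)"
    if ap: "alternating_projections (sparse_set s) (affine_set M p) x" for x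
  proof -
    have step: "x (Suc k) \<in> projector (sparse_set s) (x k - transpose M *v (M *v x k - p))" for k
    proof -
      obtain y where "y \<in> projector (affine_set M p) (x k)"
        and "x (Suc k) \<in> projector (sparse_set s) y"
        using ap unfolding alternating_projections_def by blast
      then show ?thesis using projector_affine_set[OF assms(5)] by simp
    qed
    have sparse: "x (Suc k) \<in> sparse_set s" for k
      using projectorD(1)[OF step] .
    show ?thesis
    proof (cases "\<nu> < 1")
      case True
      have lim: "x \<longlonglongrightarrow> xbar"
        by (rule alternating_projections_tendsto[where x = x, OF rip sparse xbar step])
      have "1 - \<nu> \<le> 1 / \<nu> - 1"
      proof -
        have "(1 / \<nu> - 1) - (1 - \<nu>) = (1 - \<nu>)\<^sup>2 / \<nu>"
          using \<nu> by (simp add: field_simps power2_eq_square)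
        also have "\<dots> \<ge> 0" using \<nu> by simp
        finally show ?thesis by simp
      qed
      note supp = tendsto_eventually_support[OF lim]
      \<comment> \<open>The support condition is used at \<open>k\<close> and at
        \<open>Suc k\<close>; \<open>k > 0\<close> ensures that \<open>x k\<close> is already
        sparse.\<close>
      have "eventually (\<lambda>k. norm (x (Suc k) - xbar) \<le> (1 / \<nu> - 1) * norm (x k - xbar)) sequentially"
        using supp supp[THEN eventually_sequentially_Suc[THEN iffD2]] eventually_gt_at_top[of 0]
      proof eventually_elim
        case (elim k)
        then have "x k \<in> sparse_set s" using sparse[of "k - 1"] by simp
        then have "norm (x (Suc k) - xbar) \<le> (1 - \<nu>) * norm (x k - xbar)"
          using elim by (intro hard_thresholding_local_contraction[OF rip _ xbar(2) step]) auto
        also have "\<dots> \<le> (1 / \<nu> - 1) * norm (x k - xbar)"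
          using \<open>1 - \<nu> \<le> 1 / \<nu> - 1\<close> by (intro mult_right_mono) auto
        finally show ?case .
      qed
      then show ?thesis
        using True \<nu> rate by (intro eventually_contracting_converges_linearly) auto
    next
      case False
      then have "s = 0" using rip_constant_less_one[OF assms(1,5) rip] by auto
      then have "sparse_set s = {0 :: real^'n}"
        by (auto simp: sparse_set_def l0_def vec_eq_iff)
      then have zero: "xbar = 0" "\<And>k. x (Suc k) = 0" using xbar sparse by auto
      \<comment> \<open>Here the rate is 0; the bound still holds at \<open>k = 0\<close> because
        \<open>0 ^ 0 = 1\<close>.\<close>
      have "norm (x k - xbar) \<le> norm (x 0) * (1 / \<nu> - 1) ^ k" for k
        using zero rate by (cases k) auto
      then show ?thesis
        using rate unfolding converges_linearly_def by (meson norm_ge_zero)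
    qed
  qed
  with rate unique show ?thesis by blast
qed

end
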